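(* Let $n=4k+3$ for some integer $k\geq 1$. Then there exists a signed graph $\Gamma$ which is cospectral with the path $P_n$ but not switching isomorphic with $P_n$.
   Context: A signed graph $\Gamma=(G,\sigma)$ is a simple graph $G=(V,E)$ together with a map $\sigma:E\to\{-1,+1\}$. Its adjacency matrix is obtained from the $(0,1)$-adjacency matrix of $G$ by replacing the entry $1$ by $-1$ for each negative edge; the spectrum of $\Gamma$ is the spectrum of this matrix. Two signed graphs are cospectral if they have the same spectrum. Switching with respect to a vertex subset $X$ changes the sign of every edge with exactly one end in $X$. Two signed graphs are switching isomorphic if one can be switched into a signed graph isomorphic to the other. The path $P_n$ is regarded as a signed graph with all edges positive. *)

theory Defs
  imports "Jordan_Normal_Form.Char_Poly" Complex_Main
begin

record 'a signed_graph =
  verts :: "'a set"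
  edges :: "'a set set"
  sign :: "'a set \<Rightarrow> int"

definition is_signed_graph :: "'a signed_graph \<Rightarrow> bool" where
  "is_signed_graph \<Gamma> \<longleftrightarrow>
     finite (verts \<Gamma>) \<and>
     (\<forall>e\<in>edges \<Gamma>. e \<subseteq> verts \<Gamma> \<and> card e = 2) \<and>
     (\<forall>e\<in>edges \<Gamma>. sign \<Gamma> e \<in> {-1, 1})"

text \<open>Rows and columns are indexed by the vertices in increasing order; the spectrum does not
  depend on this choice.\<close>

definition adj_mat :: "'a::linorder signed_graph \<Rightarrow> complex mat" where
  "adj_mat \<Gamma> = (let vs = sorted_list_of_set (verts \<Gamma>) in
     mat (card (verts \<Gamma>)) (card (verts \<Gamma>))
       (\<lambda>(i, j). if {vs ! i, vs ! j} \<in> edges \<Gamma> then of_int (sign \<Gamma> {vs ! i, vs ! j}) else 0))"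

text \<open>Eigenvalues counted with algebraic multiplicity.  The matrix is real symmetric, so its
  complex eigenvalues are exactly the real ones.\<close>

definition signed_spectrum :: "'a::linorder signed_graph \<Rightarrow> complex multiset" where
  "signed_spectrum \<Gamma> = proots (char_poly (adj_mat \<Gamma>))"

definition cospectral :: "'a::linorder signed_graph \<Rightarrow> 'b::linorder signed_graph \<Rightarrow> bool" where
  "cospectral \<Gamma> \<Delta> \<longleftrightarrow> signed_spectrum \<Gamma> = signed_spectrum \<Delta>"

definition switch :: "'a set \<Rightarrow> 'a signed_graph \<Rightarrow> 'a signed_graph" where
  "switch X \<Gamma> = \<Gamma>\<lparr>sign := \<lambda>e. if card (e \<inter> X) = 1 then - sign \<Gamma> e else sign \<Gamma> e\<rparr>"

definition signed_isomorphic :: "'a signed_graph \<Rightarrow> 'b signed_graph \<Rightarrow> bool" where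
  "signed_isomorphic \<Gamma> \<Delta> \<longleftrightarrow>
     (\<exists>f. bij_betw f (verts \<Gamma>) (verts \<Delta>) \<and>
          (\<forall>u\<in>verts \<Gamma>. \<forall>v\<in>verts \<Gamma>. {u, v} \<in> edges \<Gamma> \<longleftrightarrow> {f u, f v} \<in> edges \<Delta>) \<and>
          (\<forall>e\<in>edges \<Gamma>. sign \<Delta> (f ` e) = sign \<Gamma> e))"

definition switching_isomorphic :: "'a signed_graph \<Rightarrow> 'b signed_graph \<Rightarrow> bool" where
  "switching_isomorphic \<Gamma> \<Delta> \<longleftrightarrow>
     (\<exists>X \<subseteq> verts \<Gamma>. signed_isomorphic (switch X \<Gamma>) \<Delta>)"

definition path_graph :: "nat \<Rightarrow> nat signed_graph" where
  "path_graph n =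
     \<lparr>verts = {..<n}, edges = {{i, Suc i} |i. Suc i < n}, sign = (\<lambda>_. 1)\<rparr>"

lemma is_signed_graph_path_graph: "is_signed_graph (path_graph n)"
  by (auto simp: is_signed_graph_def path_graph_def)

end

theory Submission
  imports Defs
begin

text \<open>
  The cospectral mate is the disjoint union of a path on \<open>k\<close> vertices and an unbalanced 4-cycle
  \<open>a b c d\<close> with pendant paths growing out of the opposite vertices \<open>a\<close> and \<open>c\<close>, making paths of
  \<open>k\<close> and \<open>2k+1\<close> vertices that end in \<open>a\<close> and \<open>c\<close>. Since the cycle is unbalanced, \<open>b+d\<close> couples only
  to \<open>a\<close> and \<open>b-d\<close> only to \<open>c\<close>, so this component splits spectrally into two paths on \<open>k+1\<close> and
  \<open>2k+2\<close> vertices whose last edge has weight \<open>\<surd>2\<close>.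

  The path on \<open>4k+3\<close> vertices splits in the same way. Folding it about its centre, the even functions
  give the path on \<open>2k+2\<close> vertices with last edge of weight \<open>\<surd>2\<close> and the odd functions give the path
  on \<open>2k+1\<close> vertices; folding the latter once more gives the path on \<open>k+1\<close> vertices with last edge
  of weight \<open>\<surd>2\<close> and the path on \<open>k\<close> vertices. Combining the two foldings, and rescaling to avoid
  square roots, yields an explicit similarity of the adjacency matrices. The mate has a vertex
  of degree 3, so it is not switching isomorphic to a path.
\<close>

section \<open>The mate and its vertex of degree 3\<close>

text \<open>
  The vertices \<open>0, \<dots>, k-1\<close> form the path component. Then come the path \<open>k, \<dots>, 2k-1\<close> ending in
  \<open>a = 2k-1\<close>, the vertices \<open>b = 2k\<close> and \<open>d = 2k+1\<close>, and the path \<open>2k+2, \<dots>, 4k+2\<close> starting in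
  \<open>c = 2k+2\<close>. The negative edge is \<open>dc\<close>.
\<close>

definition path_mate :: "nat \<Rightarrow> nat signed_graph" where
  "path_mate k =
     \<lparr>verts = {..<4 * k + 3},
      edges = {{i, Suc i} |i. Suc i < 4 * k + 3 \<and> Suc i \<noteq> k \<and> i \<noteq> 2 * k} \<union>
        {{2 * k - 1, 2 * k + 1}, {2 * k, 2 * k + 2}},
      sign = (\<lambda>e. if e = {2 * k + 1, 2 * k + 2} then -1 else 1)\<rparr>"

lemma is_signed_graph_path_mate: "k \<ge> 1 \<Longrightarrow> is_signed_graph (path_mate k)"
  unfolding is_signed_graph_def path_mate_def by (auto simp: card_insert_if)

text \<open>Switching changes signs only, so \<open>f\<close> would map three neighbours of one
  vertex injectively to at most two neighbours in the path.\<close>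

lemma path_mate_not_switching_isomorphic:
  assumes "k \<ge> 1"
  shows "\<not> switching_isomorphic (path_mate k) (path_graph n)"
proof
  assume "switching_isomorphic (path_mate k) (path_graph n)"
  then obtain X where "signed_isomorphic (switch X (path_mate k)) (path_graph n)"
    by (auto simp: switching_isomorphic_def)
  then obtain f where f: "bij_betw f {..<4 * k + 3} {..<n}"
    and adj: "\<And>u v. u < 4 * k + 3 \<Longrightarrow> v < 4 * k + 3 \<Longrightarrow>
      {u, v} \<in> edges (path_mate k) \<Longrightarrow> {f u, f v} \<in> edges (path_graph n)"
    by (auto simp: signed_isomorphic_def switch_def path_mate_def path_graph_def)
  \<comment> \<open>This is \<open>c\<close>; the vertex \<open>a\<close> would not do, since it has
    degree 2 when \<open>k = 1\<close>.\<close>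
  let ?c = "2 * k + 2"
  have nbr: "f v = Suc (f ?c) \<or> f ?c = Suc (f v)" if "v \<in> {2 * k, 2 * k + 1, 2 * k + 3}" for v
  proof -
    have "{?c, v} \<in> edges (path_mate k)"
      using that assms by (auto simp: path_mate_def doubleton_eq_iff)
    then have "{f ?c, f v} \<in> edges (path_graph n)"
      using that assms by (intro adj) auto
    then show ?thesis
      by (auto simp: path_graph_def doubleton_eq_iff)
  qed
  have inj: "inj_on f {..<4 * k + 3}"
    using f by (rule bij_betw_imp_inj_on)
  have "f (2 * k) \<noteq> f (2 * k + 1)" "f (2 * k) \<noteq> f (2 * k + 3)" "f (2 * k + 1) \<noteq> f (2 * k + 3)"
    using assms by (simp_all add: inj_on_eq_iff[OF inj])
  then show False
    using nbr[of "2 * k"] nbr[of "2 * k + 1"] nbr[of "2 * k + 3"] by auto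
qed

section \<open>Adjacency matrices acting on functions\<close>

lemma adj_mat_index:
  assumes "verts \<Gamma> = {..<n}" "i < n" "j < n"
  shows "adj_mat \<Gamma> $$ (i, j) = (if {i, j} \<in> edges \<Gamma> then of_int (sign \<Gamma> {i, j}) else 0)"
  using assms by (simp add: adj_mat_def Let_def lessThan_atLeast0)

text \<open>The summands belong to the neighbours \<open>i - 1\<close>, \<open>i + 1\<close>,
  \<open>i + 2\<close>, \<open>i - 2\<close>. The values excluded in the first two reflect the
  missing edges between \<open>k - 1\<close> and \<open>k\<close> and between \<open>2 * k\<close>
  and \<open>2 * k + 1\<close>.\<close>

definition path_mate_op :: "nat \<Rightarrow> (nat \<Rightarrow> complex) \<Rightarrow> nat \<Rightarrow> complex" where
  "path_mate_op k \<phi> i =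
     (if 0 < i \<and> i \<noteq> k \<and> i \<noteq> 2 * k + 1 then (if i = 2 * k + 2 then -1 else 1) * \<phi> (i - 1) else 0) +
     (if Suc i < 4 * k + 3 \<and> Suc i \<noteq> k \<and> i \<noteq> 2 * k
      then (if i = 2 * k + 1 then -1 else 1) * \<phi> (Suc i) else 0) +
     (if Suc i = 2 * k \<or> i = 2 * k then \<phi> (i + 2) else 0) +
     (if i = 2 * k + 1 \<or> i = 2 * k + 2 then \<phi> (i - 2) else 0)"

text \<open>Every edge joins numbers at distance 1 or 2, so at most four entries of a row can be
  nonzero.\<close>

lemma adj_mat_path_mate_mult:
  assumes "k \<ge> 1" "i < 4 * k + 3"
  shows "(\<Sum>j<4 * k + 3. adj_mat (path_mate k) $$ (i, j) * \<phi> j) = path_mate_op k \<phi> i"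
proof -
  let ?p = "\<lambda>i. if 0 < i \<and> i \<noteq> k \<and> i \<noteq> 2 * k + 1
      then (if i = 2 * k + 2 then -1 else 1) * \<phi> (i - 1) else 0"
  let ?s = "\<lambda>i. if Suc i < 4 * k + 3 \<and> Suc i \<noteq> k \<and> i \<noteq> 2 * k
      then (if i = 2 * k + 1 then -1 else 1) * \<phi> (Suc i) else 0"
  let ?ss = "\<lambda>i. if Suc i = 2 * k \<or> i = 2 * k then \<phi> (i + 2) else 0"
  let ?pp = "\<lambda>i. if i = 2 * k + 1 \<or> i = 2 * k + 2 then \<phi> (i - 2) else 0"
  have "adj_mat (path_mate k) $$ (i, j) * \<phi> j =
      (if j = i - 1 then ?p i else 0) + (if j = Suc i then ?s i else 0) +
      (if j = i + 2 then ?ss i else 0) + (if j = i - 2 then ?pp i else 0)"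
    if "j < 4 * k + 3" for j
  proof -
    have "{i, j} \<in> edges (path_mate k) \<longleftrightarrow>
      (\<exists>l. {i, j} = {l, Suc l} \<and> Suc l < 4 * k + 3 \<and> Suc l \<noteq> k \<and> l \<noteq> 2 * k) \<or>
      {i, j} = {2 * k - 1, 2 * k + 1} \<or> {i, j} = {2 * k, 2 * k + 2}"
      unfolding path_mate_def by simp blast
    moreover have "(\<exists>l. {i, j} = {l, Suc l} \<and> Suc l < 4 * k + 3 \<and> Suc l \<noteq> k \<and> l \<noteq> 2 * k) \<longleftrightarrow>
      (j = Suc i \<and> Suc i \<noteq> k \<and> i \<noteq> 2 * k) \<or> (i = Suc j \<and> i \<noteq> k \<and> i \<noteq> 2 * k + 1)"
      using assms that by (auto simp: doubleton_eq_iff)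
    moreover have "{i, j} = {2 * k - 1, 2 * k + 1} \<longleftrightarrow>
      (j = i + 2 \<and> Suc i = 2 * k) \<or> (i = j + 2 \<and> i = 2 * k + 1)"
      unfolding doubleton_eq_iff using assms(1) by arith
    moreover have "{i, j} = {2 * k, 2 * k + 2} \<longleftrightarrow>
      (j = i + 2 \<and> i = 2 * k) \<or> (i = j + 2 \<and> i = 2 * k + 2)"
      unfolding doubleton_eq_iff by arith
    ultimately have nbr: "{i, j} \<in> edges (path_mate k) \<longleftrightarrow>
      (j = Suc i \<and> Suc i \<noteq> k \<and> i \<noteq> 2 * k) \<or> (i = Suc j \<and> i \<noteq> k \<and> i \<noteq> 2 * k + 1) \<or>
      (j = i + 2 \<and> (Suc i = 2 * k \<or> i = 2 * k)) \<or>
      (i = j + 2 \<and> (i = 2 * k + 1 \<or> i = 2 * k + 2))"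
      by argo
    have sgn: "sign (path_mate k) {i, j} =
      (if i = 2 * k + 1 \<and> j = 2 * k + 2 \<or> i = 2 * k + 2 \<and> j = 2 * k + 1 then -1 else 1)"
      by (auto simp: path_mate_def doubleton_eq_iff)
    have "adj_mat (path_mate k) $$ (i, j) =
      (if {i, j} \<in> edges (path_mate k) then of_int (sign (path_mate k) {i, j}) else 0)"
      using assms that by (intro adj_mat_index) (simp_all add: path_mate_def)
    note entry = this[unfolded nbr sgn]
    consider "j = Suc i" | "i = Suc j" | "j = i + 2" | "i = j + 2"
      | "j \<noteq> Suc i" "i \<noteq> Suc j" "j \<noteq> i + 2" "i \<noteq> j + 2"
      by blast
    then show ?thesis
    proof cases
      case 1
      then have ne: "j \<noteq> i - 1" "j \<noteq> i + 2" "j \<noteq> i - 2" "i \<noteq> Suc j" "i \<noteq> j + 2"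
        by auto
      show ?thesis
        unfolding entry
        by (simp only: ne simp_thms if_False if_True add_0_left add_0_right)
          (use 1 that in auto)
    next
      case 2
      then have ne: "j \<noteq> Suc i" "j \<noteq> i + 2" "i \<noteq> j + 2"
        by auto
      show ?thesis
        unfolding entry
        by (simp only: ne simp_thms if_False if_True add_0_left add_0_right)
          (use 2 that assms in auto)
    next
      case 3
      then have ne: "j \<noteq> i - 1" "j \<noteq> Suc i" "j \<noteq> i - 2" "i \<noteq> Suc j" "i \<noteq> j + 2"
        by auto
      show ?thesis
        unfolding entry
        by (simp only: ne simp_thms if_False if_True add_0_left add_0_right)
          (use 3 that in auto)
    next
      case 4
      then have ne: "j \<noteq> i - 1" "j \<noteq> Suc i" "j \<noteq> i + 2" "i \<noteq> Suc j"
        by auto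
      show ?thesis
        unfolding entry
        by (simp only: ne simp_thms if_False if_True add_0_left add_0_right)
          (use 4 that in auto)
    next
      case 5
      \<comment> \<open>Truncated subtraction still allows \<open>j = i - 1\<close> for
        \<open>i = 0\<close>, but then the guard in \<open>?p\<close> gives 0.\<close>
      then have "j \<noteq> i - 1 \<or> i = 0" "j \<noteq> i - 2 \<or> \<not> (i = 2 * k + 1 \<or> i = 2 * k + 2)"
        using assms by auto
      then have z: "(if j = i - 1 then ?p i else 0) = 0" "(if j = i - 2 then ?pp i else 0) = 0"
        by (elim disjE; simp only: less_irrefl simp_thms if_False if_True if_cancel)+
      show ?thesis
        unfolding entry by (simp only: 5 z simp_thms if_False) simp
    qed
  qed
  then have "(\<Sum>j<4 * k + 3. adj_mat (path_mate k) $$ (i, j) * \<phi> j) =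
      (\<Sum>j<4 * k + 3. (if j = i - 1 then ?p i else 0) + (if j = Suc i then ?s i else 0) +
      (if j = i + 2 then ?ss i else 0) + (if j = i - 2 then ?pp i else 0))"
    by (intro sum.cong refl) (simp only: lessThan_iff)
  also have "\<dots> = ?p i + ?s i + ?ss i + ?pp i"
  proof -
    have delta: "(\<Sum>j<4 * k + 3. if j = x then c else 0) = c" if "c \<noteq> 0 \<Longrightarrow> x < 4 * k + 3"
      for x and c :: complex
      using that by auto
    have "(\<Sum>j<4 * k + 3. if j = i - 1 then ?p i else 0) = ?p i"
      by (rule delta) (use assms in simp)
    moreover have "(\<Sum>j<4 * k + 3. if j = Suc i then ?s i else 0) = ?s i"
      by (rule delta) (metis (no_types))
    moreover have "(\<Sum>j<4 * k + 3. if j = i + 2 then ?ss i else 0) = ?ss i"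
      by (rule delta) (use assms in \<open>auto split: if_splits\<close>)
    moreover have "(\<Sum>j<4 * k + 3. if j = i - 2 then ?pp i else 0) = ?pp i"
      by (rule delta) (use assms in simp)
    ultimately show ?thesis
      by (simp only: sum.distrib)
  qed
  finally show ?thesis
    by (simp only: path_mate_op_def)
qed

section \<open>The folding map from the path to the mate\<close>

text \<open>
  The centre of the path is \<open>2k+1\<close>, and \<open>4k+2-j\<close> is the mirror image of \<open>j\<close>. The last case is
  the even part of the first folding. The first two cases are the odd and even parts of folding
  \<open>f i = \<phi> (2k+1+i) - \<phi> (2k+1-i)\<close> about \<open>i = k+1\<close>. The cases \<open>b\<close> and \<open>d\<close> are the sum and difference
  of the two fixed points \<open>f (k+1)\<close> and \<open>\<phi> (2k+1)\<close>.
\<close>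
definition fold_path :: "nat \<Rightarrow> (nat \<Rightarrow> complex) \<Rightarrow> nat \<Rightarrow> complex" where
  "fold_path k \<phi> j =
     (if j < k then \<phi> (4 * k + 2 - j) - \<phi> j - \<phi> (2 * k + 2 + j) + \<phi> (2 * k - j)
      else if j < 2 * k then \<phi> (5 * k + 2 - j) - \<phi> (j - k) + \<phi> (k + 2 + j) - \<phi> (3 * k - j)
      else if j = 2 * k then \<phi> (3 * k + 2) - \<phi> k + \<phi> (2 * k + 1)
      else if j = 2 * k + 1 then \<phi> (3 * k + 2) - \<phi> k - \<phi> (2 * k + 1)
      else \<phi> j + \<phi> (4 * k + 2 - j))"

text \<open>By linearity, folding is multiplication by the matrix whose columns are the folded
  indicator functions.\<close>

lemma fold_path_sum:
  assumes "j < 4 * k + 3"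
  shows "(\<Sum>p<4 * k + 3. fold_path k (\<lambda>x. if x = p then 1 else 0) j * \<phi> p) = fold_path k \<phi> j"
proof -
  have delta: "(\<Sum>p<4 * k + 3. (if x = p then 1 else 0) * \<phi> p) = \<phi> x" if "x < 4 * k + 3" for x
    using that by (simp add: if_distrib[of "\<lambda>y. y * _"] cong: if_cong)
  show ?thesis
    unfolding fold_path_def using assms
    by (auto simp only: ring_distribs left_diff_distrib sum.distrib sum_subtractf delta
        if_True if_False simp_thms split: if_splits)
qed

text \<open>The intertwining of the two adjacency matrices, stated for functions so that it can be
  checked vertex by vertex.\<close>

lemma fold_path_intertwines:
  assumes "k \<ge> 1" "j < 4 * k + 3"
  shows "path_mate_op k (fold_path k \<phi>) j =
    fold_path k (\<lambda>i. (if 0 < i then \<phi> (i - 1) else 0) +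
      (if Suc i < 4 * k + 3 then \<phi> (Suc i) else 0)) j"
proof -
  consider (u) "j < k" | (a) "k \<le> j" "j < 2 * k" | "j = 2 * k"
    | "j = 2 * k + 1" | "j = 2 * k + 2" | (c) "2 * k + 2 < j"
    by linarith
  then show ?thesis
  proof cases
    case u
    \<comment> \<open>This substitution removes truncated subtraction; \<open>j = 0\<close> and
      \<open>d = 0\<close> are the ends of the path component.\<close>
    then obtain d where k: "k = j + d + 1"
      by (metis Suc_eq_plus1 add_Suc_right less_iff_Suc_add)
    show ?thesis
      unfolding k
      by (cases j; cases d; simp add: path_mate_op_def fold_path_def)
        (simp_all add: algebra_simps eval_nat_numeral)
  next
    case a
    then obtain x where j: "j = k + x" using le_Suc_ex by auto
    with a obtain d where k: "k = x + d + 1"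
      by (metis Suc_eq_plus1 add_Suc_right less_iff_Suc_add mult_2 nat_add_left_cancel_less)
    show ?thesis
      unfolding j k
      by (cases x; cases d; simp add: path_mate_op_def fold_path_def)
        (simp_all add: algebra_simps eval_nat_numeral)
  next
    case c
    then obtain i where j: "j = Suc i" "2 * k + 1 < i"
      by (cases j) auto
    \<comment> \<open>The mirror image of \<open>j\<close>; reflection exchanges predecessor and
      successor.\<close>
    define m where "m = 4 * k + 2 - j"
    have "4 * k + 2 - i = Suc m" "4 * k + 2 - Suc j = m - 1" "4 * k + 2 - j = m"
      "0 < m \<longleftrightarrow> Suc j < 4 * k + 3" "m < 2 * k + 1"
      using j assms by (auto simp: m_def)
    then show ?thesis
      using j by (simp add: path_mate_op_def fold_path_def)
  next
    case 3
    obtain k' where k: "k = Suc k'"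
      using assms(1) by (cases k) auto
    show ?thesis
      unfolding 3 k
      by (simp add: path_mate_op_def fold_path_def) (simp_all add: algebra_simps eval_nat_numeral)
  next
    case 4
    obtain k' where k: "k = Suc k'"
      using assms(1) by (cases k) auto
    show ?thesis
      unfolding 4 k
      by (simp add: path_mate_op_def fold_path_def) (simp_all add: algebra_simps eval_nat_numeral)
  next
    case 5
    obtain k' where k: "k = Suc k'"
      using assms(1) by (cases k) auto
    show ?thesis
      unfolding 5 k by (simp add: path_mate_op_def fold_path_def)
  qed
qed

text \<open>Each folding stores a sum and a difference, from which both terms can be
  recovered.\<close>

lemma fold_path_inj:
  assumes zero: "\<And>j. j < 4 * k + 3 \<Longrightarrow> fold_path k \<phi> j = 0" and "p < 4 * k + 3"
  shows "\<phi> p = 0"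
proof -
  have c: "\<phi> (2 * k + 1 + i) = - \<phi> (2 * k + 1 - i)" if "1 \<le> i" "i \<le> 2 * k + 1" for i
    using zero[of "2 * k + 1 + i"] that by (simp add: fold_path_def eq_neg_iff_add_eq_0)
  have mid: "\<phi> (2 * k + 1) = 0" and fk: "\<phi> (3 * k + 2) = \<phi> k"
    using zero[of "2 * k"] zero[of "2 * k + 1"] by (simp_all add: fold_path_def)
  define f where "f i = \<phi> (2 * k + 1 + i) - \<phi> (2 * k + 1 - i)" for i
  have f: "f (k + 1 + i) = 0 \<and> f (k + 1 - i) = 0" if "1 \<le> i" "i \<le> k" for i
  proof -
    have "f (k + 1 + i) - f (k + 1 - i) = 0"
      using zero[of "k - i"] that by (simp add: fold_path_def f_def algebra_simps Suc_diff_le)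
    moreover have "f (k + 1 + i) + f (k + 1 - i) = 0"
    proof -
      have "2 * k - i < 4 * k + 3" "\<not> 2 * k - i < k" "2 * k - i < 2 * k"
        "5 * k + 2 - (2 * k - i) = 3 * k + 2 + i" "2 * k - i - k = k - i"
        "k + 2 + (2 * k - i) = 3 * k + 2 - i" "3 * k - (2 * k - i) = k + i"
        using that by auto
      then have "\<phi> (3 * k + 2 + i) - \<phi> (k - i) + \<phi> (3 * k + 2 - i) - \<phi> (k + i) = 0"
        using zero[of "2 * k - i"] by (simp only: fold_path_def if_True if_False simp_thms)
      moreover have "2 * k + 1 + (k + 1 + i) = 3 * k + 2 + i" "2 * k + 1 - (k + 1 + i) = k - i"
        "2 * k + 1 + (k + 1 - i) = 3 * k + 2 - i" "2 * k + 1 - (k + 1 - i) = k + i"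
        using that by auto
      ultimately show ?thesis
        by (simp only: f_def) (simp add: algebra_simps)
    qed
    ultimately show ?thesis by auto
  qed
  have "f i = 0" if "1 \<le> i" "i \<le> 2 * k + 1" for i
  proof -
    consider "i < k + 1" | "i = k + 1" | "k + 1 < i" by linarith
    then show ?thesis
    proof cases
      case 1
      then show ?thesis using f[of "k + 1 - i"] that by simp
    next
      case 2
      then show ?thesis using fk by (simp add: f_def)
    next
      case 3
      then show ?thesis using f[of "i - (k + 1)"] that by simp
    qed
  qed
  \<comment> \<open>Antisymmetry \<open>c\<close> turns \<open>f i\<close> into twice
    \<open>\<phi> (2 * k + 1 + i)\<close>.\<close>
  then have z: "\<phi> (2 * k + 1 + i) = 0 \<and> \<phi> (2 * k + 1 - i) = 0" if "1 \<le> i" "i \<le> 2 * k + 1" for i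
    using c[OF that] that by (simp add: f_def)
  consider "p < 2 * k + 1" | "p = 2 * k + 1" | "2 * k + 1 < p" by linarith
  then show ?thesis
  proof cases
    case 1
    then show ?thesis using z[of "2 * k + 1 - p"] by simp
  next
    case 2
    then show ?thesis using mid by simp
  next
    case 3
    then show ?thesis using z[of "p - (2 * k + 1)"] assms(2) by simp
  qed
qed

section \<open>From intertwining to cospectrality\<close>

text \<open>A square matrix with trivial kernel is invertible, so the intertwining is a
  similarity.\<close>

lemma char_poly_eq_if_intertwined:
  fixes A B M :: "'a::field mat"
  assumes A: "A \<in> carrier_mat n n" and B: "B \<in> carrier_mat n n" and M: "M \<in> carrier_mat n n"
    and "A * M = M * B"
    and inj: "\<And>v. v \<in> carrier_vec n \<Longrightarrow> M *\<^sub>v v = 0\<^sub>v n \<Longrightarrow> v = 0\<^sub>v n"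
  shows "char_poly A = char_poly B"
proof -
  have "det M \<noteq> 0"
    using inj det_0_iff_vec_prod_zero_field[OF M] by blast
  then have "M \<in> Units (ring_mat TYPE('a) n ())"
    by (rule det_non_zero_imp_unit[OF M])
  then obtain N where N: "N \<in> carrier_mat n n" "M * N = 1\<^sub>m n" "N * M = 1\<^sub>m n"
    by (auto simp: Units_def ring_mat_simps)
  have "A = A * (M * N)"
    using A N by simp
  also have "\<dots> = M * B * N"
    using assoc_mult_mat[OF A M N(1)] \<open>A * M = M * B\<close> by simp
  finally have "similar_mat A B"
    using A B M N by (intro similar_matI[where P = M and Q = N and n = n]) auto
  then show ?thesis
    by (rule char_poly_similar)
qed

lemma cospectral_path_mate:
  assumes "k \<ge> 1"
  shows "cospectral (path_mate k) (path_graph (4 * k + 3))"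
proof -
  let ?n = "4 * k + 3"
  let ?A = "adj_mat (path_mate k)" and ?B = "adj_mat (path_graph ?n)"
  define M where "M = mat ?n ?n (\<lambda>(j, p). fold_path k (\<lambda>x. if x = p then 1 else 0) j)"
  have A: "?A \<in> carrier_mat ?n ?n" and B: "?B \<in> carrier_mat ?n ?n"
    by (simp_all add: adj_mat_def Let_def path_mate_def path_graph_def)
  have M: "M \<in> carrier_mat ?n ?n"
    by (simp add: M_def)
  \<comment> \<open>The entry is the neighbour sum at \<open>p\<close> of the indicator of
    \<open>q\<close>, the form in which \<open>fold_path_intertwines\<close> applies.\<close>
  have B_delta: "?B $$ (p, q) = (if 0 < p then if p - 1 = q then 1 else 0 else 0) +
      (if Suc p < ?n then if Suc p = q then 1 else 0 else 0)" if "p < ?n" "q < ?n" for p q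
    using that adj_mat_index[of "path_graph ?n" ?n p q]
    by (auto simp: path_graph_def doubleton_eq_iff)
  have "?A * M = M * ?B"
  proof (rule eq_matI)
    fix j q assume "j < dim_row (M * ?B)" "q < dim_col (M * ?B)"
    then have jq: "j < ?n" "q < ?n"
      using M B by auto
    let ?\<delta> = "\<lambda>x. if x = q then 1 else 0 :: complex"
    have "(?A * M) $$ (j, q) = (\<Sum>l<?n. ?A $$ (j, l) * fold_path k ?\<delta> l)"
      using jq A M by (simp add: scalar_prod_def lessThan_atLeast0 M_def)
    also have "\<dots> = fold_path k (\<lambda>i. (if 0 < i then ?\<delta> (i - 1) else 0) +
        (if Suc i < ?n then ?\<delta> (Suc i) else 0)) j"
      using assms jq(1) by (simp only: adj_mat_path_mate_mult fold_path_intertwines)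
    also have "\<dots> = (\<Sum>p<?n. fold_path k (\<lambda>x. if x = p then 1 else 0) j *
        ((if 0 < p then ?\<delta> (p - 1) else 0) + (if Suc p < ?n then ?\<delta> (Suc p) else 0)))"
      by (rule fold_path_sum[OF jq(1), symmetric])
    also have "\<dots> = (\<Sum>p<?n. M $$ (j, p) * ?B $$ (p, q))"
      using jq by (intro sum.cong) (simp_all only: B_delta lessThan_iff M_def index_mat split_conv)
    also have "\<dots> = (M * ?B) $$ (j, q)"
      using jq M B by (simp add: scalar_prod_def lessThan_atLeast0)
    finally show "(?A * M) $$ (j, q) = (M * ?B) $$ (j, q)" .
  qed (use A B M in auto)
  moreover have "v = 0\<^sub>v ?n" if v: "v \<in> carrier_vec ?n" "M *\<^sub>v v = 0\<^sub>v ?n" for v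
  proof (rule eq_vecI)
    have "fold_path k (\<lambda>p. v $ p) j = 0" if "j < ?n" for j
    proof -
      have "(M *\<^sub>v v) $ j = fold_path k (\<lambda>p. v $ p) j"
        using that v(1) fold_path_sum[OF that, of "\<lambda>p. v $ p"]
        by (simp add: M_def scalar_prod_def lessThan_atLeast0)
      then show ?thesis
        using that v(2) by simp
    qed
    then show "v $ p = 0\<^sub>v ?n $ p" if "p < dim_vec (0\<^sub>v ?n)" for p
      using that fold_path_inj[of k "\<lambda>p. v $ p" p] by simp
  qed (use v in simp)
  ultimately have "char_poly ?A = char_poly ?B"
    by (rule char_poly_eq_if_intertwined[OF A B M])
  then show ?thesis
    by (simp add: cospectral_def signed_spectrum_def)
qed

theorem theorem5p2:
  fixes n k :: nat
  assumes "k \<ge> 1" and "n = 4 * k + 3"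
  shows "\<exists>\<Gamma> :: nat signed_graph. is_signed_graph \<Gamma> \<and>
           cospectral \<Gamma> (path_graph n) \<and> \<not> switching_isomorphic \<Gamma> (path_graph n)"
  unfolding assms(2) using is_signed_graph_path_mate[OF assms(1)] cospectral_path_mate[OF assms(1)]
    path_mate_not_switching_isomorphic[OF assms(1)]
  by (intro exI[of _ "path_mate k"] conjI)

end
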